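(* For every planar convex set $\Omega$ the inequality $$|\Omega|\ge R(\Omega)\,\bigl(2P(\Omega)-3\pi R(\Omega)\bigr)$$ holds, with equality for a ball. Moreover, this inequality improves the inequality $|\Omega|\ge R(\Omega)(P(\Omega)-4R(\Omega))$ when $P(\Omega)\ge(3\pi-4)R(\Omega)$, i.e. in that case $R(\Omega)(2P(\Omega)-3\pi R(\Omega))\ge R(\Omega)(P(\Omega)-4R(\Omega))$.
   Context: $\Omega\subseteq\mathbb{R}^2$ is a compact convex set; $|\Omega|$ is its area, $P(\Omega)$ its perimeter, and $R(\Omega)$ its circumradius (radius of the smallest disc containing $\Omega$). For a degenerate convex set (a segment) the perimeter is twice its length. *)

theory Defs
  imports "HOL-Analysis.Analysis"
begin

(* Radius of the smallest disc containing S.  Radii are required to be nonnegative because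
   cball c r is empty for r < 0. *)
definition circumradius :: "(real^2) set \<Rightarrow> real" where
  "circumradius S = Inf {r. 0 \<le> r \<and> (\<exists>c. S \<subseteq> cball c r)}"

definition orient :: "real^2 \<Rightarrow> real^2 \<Rightarrow> real^2 \<Rightarrow> real" where
  "orient x y z = (y$1 - x$1) * (z$2 - x$2) - (y$2 - x$2) * (z$1 - x$1)"

(* The points of the list are, in this order, the vertices of a strictly convex polygon traversed
   counterclockwise.  The condition is vacuous for at most two points: a pair of points is a
   degenerate polygon with two sides. *)
definition convex_polygon :: "(real^2) list \<Rightarrow> bool" where
  "convex_polygon p \<longleftrightarrow>
     (\<forall>i j k. i < j \<and> j < k \<and> k < length p \<longrightarrow> 0 < orient (p ! i) (p ! j) (p ! k))"

definition polygon_length :: "(real^2) list \<Rightarrow> real" where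
  "polygon_length p = (\<Sum>i<length p. dist (p ! i) (p ! (Suc i mod length p)))"

(* The length of the closed convex boundary curve of S, i.e. the supremum of the lengths of the
   polygons inscribed in it.  The strict convexity of the polygons forces their vertices to follow
   the cyclic order of the boundary.  If S is a segment, only polygons with at most two vertices
   are inscribed, and the perimeter is twice the length of the segment. *)
definition perimeter :: "(real^2) set \<Rightarrow> real" where
  "perimeter S = Sup {polygon_length p | p. convex_polygon p \<and> set p \<subseteq> frontier S}"

lemma dist_in_closed_segment_pair:
  fixes a b x y :: "'a::euclidean_space"
  assumes "x \<in> closed_segment a b" "y \<in> closed_segment a b"
  shows "dist x y \<le> dist a b"
proof -
  obtain r where r: "0 \<le> r" "r \<le> 1" "x = (1 - r) *\<^sub>R a + r *\<^sub>R b"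
    using assms(1) unfolding in_segment by blast
  obtain s where s: "0 \<le> s" "s \<le> 1" "y = (1 - s) *\<^sub>R a + s *\<^sub>R b"
    using assms(2) unfolding in_segment by blast
  have "x - y = (s - r) *\<^sub>R (a - b)"
    unfolding r(3) s(3) by (simp add: algebra_simps)
  then have "dist x y = \<bar>s - r\<bar> * dist a b"
    by (simp add: dist_norm)
  also have "\<dots> \<le> 1 * dist a b"
    using r s by (intro mult_right_mono) auto
  finally show ?thesis by simp
qed

lemma perimeter_closed_segment: "perimeter (closed_segment a b) = 2 * dist a b"
proof -
  have front: "frontier (closed_segment a b) \<subseteq> closed_segment a b"
    by (simp add: frontier_subset_eq)
  have ends: "a \<in> frontier (closed_segment a b)" "b \<in> frontier (closed_segment a b)"
    using extreme_point_of_segment[of _ a b]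
    by (auto simp: frontier_def dest: extreme_point_not_in_interior)
  have collinear: "orient x y z = 0"
    if "x \<in> closed_segment a b" "y \<in> closed_segment a b" "z \<in> closed_segment a b" for x y z
  proof -
    obtain r where "x = (1 - r) *\<^sub>R a + r *\<^sub>R b"
      using \<open>x \<in> _\<close> unfolding in_segment by blast
    moreover obtain s where "y = (1 - s) *\<^sub>R a + s *\<^sub>R b"
      using \<open>y \<in> _\<close> unfolding in_segment by blast
    moreover obtain t where "z = (1 - t) *\<^sub>R a + t *\<^sub>R b"
      using \<open>z \<in> _\<close> unfolding in_segment by blast
    ultimately show ?thesis by (simp add: orient_def) (simp add: algebra_simps)
  qed
  have "polygon_length p \<le> 2 * dist a b"
    if p: "convex_polygon p" "set p \<subseteq> frontier (closed_segment a b)" for p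
  proof -
    have mem: "p ! i \<in> closed_segment a b" if "i < length p" for i
      using that p(2) front nth_mem by blast
    have "length p \<le> 2"
    proof (rule ccontr)
      assume "\<not> length p \<le> 2"
      then have len: "2 < length p" by simp
      then have "0 < orient (p ! 0) (p ! 1) (p ! 2)"
        using p(1) by (auto simp: convex_polygon_def)
      moreover have "orient (p ! 0) (p ! 1) (p ! 2) = 0"
        using len by (intro collinear mem) auto
      ultimately show False by simp
    qed
    then consider "length p = 0" | "length p = 1" | "length p = 2" by linarith
    then show ?thesis
    proof cases
      case 3
      have "dist (p ! 0) (p ! 1) \<le> dist a b"
        by (rule dist_in_closed_segment_pair) (use mem 3 in auto)
      then show ?thesis using 3
        by (simp add: polygon_length_def dist_commute numeral_2_eq_2)
    qed (auto simp: polygon_length_def)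
  qed
  moreover have "convex_polygon [a, b]" "polygon_length [a, b] = 2 * dist a b"
    by (auto simp: convex_polygon_def polygon_length_def dist_commute)
  ultimately show ?thesis
    unfolding perimeter_def using ends
    by (intro cSup_eq_maximum) (auto intro!: exI[of _ "[a, b]"])
qed

end

theory Submission
  imports Defs
begin

text \<open>
  Let \<open>\<Omega>\<close> lie in a disc of radius \<open>r\<close> about the origin and let \<open>h(t)\<close> be its support function.  Then
  \<open>|\<Omega>| = 1/2 \<integral> (h\<^sup>2 - h'\<^sup>2)\<close> and \<open>P(\<Omega>) = \<integral> h\<close>, both over a full turn, so
  \<open>|\<Omega>| - 2 r P(\<Omega>) + 3 \<pi> r\<^sup>2\<close> is the integral of \<open>(h\<^sup>2 - h'\<^sup>2) / 2 - 2 r h + 3/2 r\<^sup>2\<close>.  The boundary point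
  with outer normal direction \<open>t\<close> has squared norm \<open>h\<^sup>2 + h'\<^sup>2\<close>, which is at most \<open>r\<^sup>2\<close>; hence the
  integrand is at least \<open>h\<^sup>2 - 2 r h + r\<^sup>2 = (r - h)\<^sup>2\<close>, which is nonnegative.

  As the perimeter is the supremum of the lengths of inscribed polygons, this argument is only carried
  out for a polygon, where all integrals are explicit.  While the normal turns around a vertex \<open>x\<close>, the
  support function is \<open>h(t) = x \<bullet> \<nu>(t)\<close>, and the integrand has the antiderivative
  \<open>2 r h' - h h' / 2 + 3/2 r\<^sup>2 t\<close>, which is therefore nondecreasing (\<open>vertex_potential_mono\<close>).
  Across an edge of length \<open>l\<close> the value \<open>h\<close> is continuous and \<open>h'\<close> jumps by \<open>l\<close>.  Summing the increments over
  the vertices thus leaves a sum over the edges, consisting of the shoelace terms and the lengths, plus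
  \<open>3/2 r\<^sup>2\<close> times the total turning.  That the total turning of a strictly convex polygon is a single
  full turn is \<open>convex_polygon_edge_angles\<close>.  The shoelace sum equals twice the area of the fan
  triangulation from one vertex, which lies in \<open>\<Omega>\<close>.

  The resulting bound on the length holds for every radius \<open>r\<close> above the circumradius, hence by
  continuity for the circumradius itself, and passes to the supremum.  For a disc of radius \<open>r\<close> the
  same bound shows that the perimeter is at most \<open>2 \<pi> r\<close>, and regular inscribed polygons show that it is no less.
  The comparison of the two lower bounds is linear arithmetic in \<open>P(\<Omega>)\<close>, once \<open>R(\<Omega>) \<ge> 0\<close> is known.
\<close>

section \<open>Plane vectors and cyclic sums\<close>

definition wedge :: "real^2 \<Rightarrow> real^2 \<Rightarrow> real" where
  "wedge u v = u$1 * v$2 - u$2 * v$1"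

definition unit_vec :: "real \<Rightarrow> real^2" where
  "unit_vec a = vector [cos a, sin a]"

lemma unit_vec_nth [simp]: "unit_vec a $ 1 = cos a" "unit_vec a $ 2 = sin a"
  by (simp_all add: unit_vec_def)

lemma vec2_eq_iff: "(x::real^2) = y \<longleftrightarrow> x$1 = y$1 \<and> x$2 = y$2"
  by (auto simp: vec_eq_iff forall_2)

lemma orient_eq_wedge: "orient x y z = wedge (y - x) (z - x)"
  by (simp add: orient_def wedge_def)

lemma norm_vec2_sq: "(norm (x::real^2))^2 = (x$1)^2 + (x$2)^2"
  by (simp add: norm_vec_def L2_set_def sum_2)

lemma cyclic_sum_shift:
  fixes f :: "nat \<Rightarrow> 'a::comm_monoid_add"
  shows "(\<Sum>k<n. f (Suc k mod n)) = (\<Sum>k<n. f k)"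
proof (cases n)
  case (Suc m)
  have "(\<Sum>k<n. f (Suc k mod n)) = (\<Sum>k<m. f (Suc k)) + f 0"
    by (simp add: Suc)
  then show ?thesis
    by (simp add: Suc sum.lessThan_Suc_shift add.commute del: sum.lessThan_Suc)
qed simp

section \<open>The turning of a strictly convex polygon\<close>

text \<open>
  Taking for \<open>d\<close> the first edge of a convex polygon puts the jump of the angle from \<open>2 \<pi>\<close> to \<open>0\<close> at
  the start of the polygon, so that the angles of its edges increase without wrapping around.
\<close>
lemma relative_angle_exists:
  fixes d :: "real^2"
  assumes "d \<noteq> 0"
  obtains \<phi> :: "real^2 \<Rightarrow> real" and \<alpha> :: real
  where "\<And>v. 0 \<le> \<phi> v" "\<And>v. \<phi> v < 2 * pi" "\<phi> d = 0"
    "\<And>v. v = norm v *\<^sub>R unit_vec (\<alpha> + \<phi> v)"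
proof -
  define c where "c v = Complex (v$1) (v$2)" for v :: "real^2"
  define \<phi> where "\<phi> v = Arg2pi (c v / c d)" for v
  define \<alpha> where "\<alpha> = Arg2pi (c d)"
  have norm_c: "cmod (c v) = norm v" for v
    by (simp add: c_def complex_norm norm_vec_def L2_set_def sum_2)
  have "c d \<noteq> 0" using assms norm_c[of d] by auto
  have polar: "z = rcis (cmod z) (Arg2pi z)" for z
    using Arg2pi_eq[of z] by (simp add: rcis_def cis_conv_exp)
  have "c v = rcis (norm v) (\<alpha> + \<phi> v)" for v
  proof -
    have "c v = c d * (c v / c d)" using \<open>c d \<noteq> 0\<close> by simp
    also have "\<dots> = rcis (cmod (c d)) \<alpha> * rcis (cmod (c v / c d)) (\<phi> v)"
      unfolding \<phi>_def \<alpha>_def using polar[of "c d"] polar[of "c v / c d"] by metis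
    also have "\<dots> = rcis (norm v) (\<alpha> + \<phi> v)"
      using assms by (simp add: rcis_mult norm_divide norm_c)
    finally show ?thesis .
  qed
  then have "Re (c v) = norm v * cos (\<alpha> + \<phi> v)" "Im (c v) = norm v * sin (\<alpha> + \<phi> v)" for v
    by (metis Re_rcis) (metis Im_rcis \<open>\<And>v. c v = rcis (norm v) (\<alpha> + \<phi> v)\<close>)
  then have "v $ 1 = norm v * cos (\<alpha> + \<phi> v)" "v $ 2 = norm v * sin (\<alpha> + \<phi> v)" for v
    by (simp_all add: c_def)
  then have "v = norm v *\<^sub>R unit_vec (\<alpha> + \<phi> v)" for v
    unfolding vec2_eq_iff by (metis unit_vec_nth vector_scaleR_component real_scaleR_def)
  moreover have "\<phi> d = 0" using \<open>c d \<noteq> 0\<close> by (simp add: \<phi>_def Arg2pi_eq_0)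
  ultimately show thesis
    using that[of \<phi> \<alpha>] Arg2pi_ge_0 Arg2pi_lt_2pi by (auto simp: \<phi>_def)
qed

lemma sin_pos_interval:
  assumes "0 < sin x" "- pi < x" "x < 2 * pi"
  shows "0 < x \<and> x < pi"
proof -
  have "0 < x"
    using assms sin_ge_zero[of "- x"] by (force simp: not_less[symmetric])
  moreover have "x < pi"
    using assms sin_ge_zero[of "x - pi"] by (force simp: not_less[symmetric])
  ultimately show ?thesis by simp
qed

text \<open>
  Let \<open>\<delta> k\<close> be the angle of the diagonal from vertex \<open>0\<close> to vertex \<open>k\<close>, measured from the first edge.
  These angles increase from \<open>0\<close> and stay below \<open>\<pi>\<close>.  An edge from vertex \<open>k\<close> to \<open>k + 1\<close> that avoids
  vertex \<open>0\<close> moves counterclockwise as seen from there, so its angle lies between \<open>\<delta> (k + 1)\<close> and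
  \<open>\<delta> k + \<pi>\<close>.  The angles of two consecutive edges of this kind therefore differ by less than \<open>\<pi>\<close>, and
  the positive orientation of their three vertices makes the difference positive.  The first edge has
  angle \<open>0\<close>, and the closing edge has angle \<open>\<delta> (n - 1) + \<pi>\<close>, which is less than \<open>2 \<pi>\<close>; this is what limits
  the turning to one full turn.
\<close>
lemma convex_polygon_edge_angles:
  assumes p: "convex_polygon p" and n: "n = length p" "3 \<le> n"
  obtains a :: "nat \<Rightarrow> real"
  where "\<And>k. k < n \<Longrightarrow>
      p ! (Suc k mod n) - p ! k = dist (p ! k) (p ! (Suc k mod n)) *\<^sub>R unit_vec (a k)"
    "\<And>k. Suc k < n \<Longrightarrow> a k \<le> a (Suc k)" "a (n - 1) \<le> a 0 + 2 * pi"
proof -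
  define d where "d k = p ! k - p ! 0" for k
  have orient_pos: "0 < orient (p ! i) (p ! j) (p ! k)" if "i < j" "j < k" "k < n" for i j k
    using p that n unfolding convex_polygon_def by blast
  have d_pos: "0 < wedge (d j) (d k)" if "1 \<le> j" "j < k" "k < n" for j k
    using orient_pos[of 0 j k] that by (simp add: orient_eq_wedge d_def)
  have "d 1 \<noteq> 0" using d_pos[of 1 2] n by (auto simp: wedge_def)
  then obtain \<phi> \<alpha> where \<phi>: "\<And>v. 0 \<le> \<phi> v" "\<And>v. \<phi> v < 2 * pi" "\<phi> (d 1) = 0"
    and polar: "\<And>v. v = norm v *\<^sub>R unit_vec (\<alpha> + \<phi> v)"
    using relative_angle_exists by metis
  have wedge_sin: "wedge u v = norm u * norm v * sin (\<phi> v - \<phi> u)" for u v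
  proof -
    have "wedge u v = wedge (norm u *\<^sub>R unit_vec (\<alpha> + \<phi> u)) (norm v *\<^sub>R unit_vec (\<alpha> + \<phi> v))"
      using polar by metis
    also have "\<dots> = norm u * norm v * sin ((\<alpha> + \<phi> v) - (\<alpha> + \<phi> u))"
      by (simp only: sin_diff) (simp add: wedge_def algebra_simps)
    finally show ?thesis by simp
  qed
  have sin_pos: "0 < sin (\<phi> v - \<phi> u)" if "0 < wedge u v" for u v
    using that unfolding wedge_sin by (meson mult_nonneg_nonneg mult_nonneg_nonpos norm_ge_zero not_le)
  define \<delta> where "\<delta> k = \<phi> (d k)" for k
  define e where "e k = p ! Suc k - p ! k" for k
  have \<delta>1: "\<delta> 1 = 0" unfolding \<delta>_def by (rule \<phi>(3))
  have \<delta>_lt_pi: "0 < \<delta> k \<and> \<delta> k < pi" if "2 \<le> k" "k < n" for k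
  proof -
    have "0 < sin (\<delta> k - \<delta> 1)" unfolding \<delta>_def
      by (rule sin_pos) (use d_pos[of 1 k] that in auto)
    then show ?thesis using \<delta>1 \<phi>(1,2)[of "d k"] pi_gt_zero
      by (intro sin_pos_interval) (auto simp: \<delta>_def intro: less_le_trans)
  qed
  have \<delta>_range: "0 \<le> \<delta> k \<and> \<delta> k < pi" if "1 \<le> k" "k < n" for k
    using \<delta>1 \<delta>_lt_pi[of k] that by (cases "k = 1") auto
  have \<delta>_mono: "\<delta> k < \<delta> (Suc k)" if k: "1 \<le> k" "Suc k < n" for k
  proof -
    have "0 < sin (\<delta> (Suc k) - \<delta> k)"
      unfolding \<delta>_def by (rule sin_pos) (use d_pos[of k "Suc k"] k in simp)
    then show ?thesis
      using sin_pos_interval[of "\<delta> (Suc k) - \<delta> k"] \<delta>_range[of k] \<delta>_range[of "Suc k"] k by simp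
  qed
  have edge_between: "\<delta> (Suc k) < \<phi> (e k) \<and> \<phi> (e k) < \<delta> k + pi" if k: "1 \<le> k" "Suc k < n" for k
  proof -
    have "wedge (d k) (e k) = wedge (d k) (d (Suc k))" "wedge (d (Suc k)) (e k) = wedge (d k) (d (Suc k))"
      by (simp_all add: wedge_def d_def e_def algebra_simps)
    then have *: "0 < sin (\<phi> (e k) - \<delta> k)" "0 < sin (\<phi> (e k) - \<delta> (Suc k))"
      using d_pos[of k "Suc k"] k sin_pos by (auto simp: \<delta>_def)
    show ?thesis
      using sin_pos_interval[OF *(1)] sin_pos_interval[OF *(2)] \<phi>(1,2)[of "e k"]
        \<delta>_range[of k] \<delta>_range[of "Suc k"] k by simp
  qed
  \<comment> \<open>The closing edge reverses the last diagonal, so its angle may be written down directly.\<close>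
  define a where "a k = (if k = n - 1 then \<delta> k + pi else \<phi> (e k))" for k
  have a_mono: "a k \<le> a (Suc k)" if k: "Suc k < n" for k
  proof (cases "k = 0")
    case True
    have "e 0 = d 1" by (simp add: e_def d_def)
    then have "a 0 = 0" using n \<phi>(3) by (simp add: a_def)
    then show ?thesis using True \<delta>_range[of 1] \<phi>(1)[of "e 1"] \<delta>1 n by (auto simp: a_def)
  next
    case False
    show ?thesis
    proof (cases "Suc k = n - 1")
      case True
      then show ?thesis
        using edge_between[of k] \<delta>_mono[of k] False k by (simp add: a_def)
    next
      case False
      have "0 < wedge (e k) (e (Suc k))"
        using orient_pos[of k "Suc k" "Suc (Suc k)"] k False
        by (simp add: orient_eq_wedge e_def) (simp add: wedge_def algebra_simps)
      then have "0 < sin (\<phi> (e (Suc k)) - \<phi> (e k))" by (rule sin_pos)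
      moreover have "1 \<le> k" "Suc (Suc k) < n" using \<open>k \<noteq> 0\<close> False k by auto
      moreover from this have "\<phi> (e k) < \<delta> k + pi" "\<delta> (Suc k) < \<delta> (Suc (Suc k))" "\<delta> k < \<delta> (Suc k)"
        "\<delta> (Suc k) < \<phi> (e k)" "\<delta> (Suc (Suc k)) < \<phi> (e (Suc k))" "\<phi> (e (Suc k)) < \<delta> (Suc k) + pi"
        using edge_between[of k] edge_between[of "Suc k"] \<delta>_mono[of k] \<delta>_mono[of "Suc k"] by simp_all
      ultimately have "\<phi> (e k) < \<phi> (e (Suc k))"
        using sin_pos_interval[of "\<phi> (e (Suc k)) - \<phi> (e k)"] by linarith
      then show ?thesis using False k by (auto simp: a_def)
    qed
  qed
  have a_total: "a (n - 1) \<le> a 0 + 2 * pi"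
  proof -
    have "0 \<le> a 0" using n \<phi>(1) by (simp add: a_def)
    moreover have "a (n - 1) < 2 * pi"
      using \<delta>_range[of "n - 1"] n(2) by (simp add: a_def)
    ultimately show ?thesis by simp
  qed
  have a_edge: "p ! (Suc k mod n) - p ! k
      = dist (p ! k) (p ! (Suc k mod n)) *\<^sub>R unit_vec (\<alpha> + a k)" if "k < n" for k
  proof (cases "k = n - 1")
    case True
    then have mod: "Suc k mod n = 0" using that by simp
    have "d k = norm (d k) *\<^sub>R unit_vec (\<alpha> + \<delta> k)" unfolding \<delta>_def by (rule polar)
    moreover have "unit_vec (\<alpha> + a k) = - unit_vec (\<alpha> + \<delta> k)"
      using True by (simp add: a_def vec2_eq_iff flip: add.assoc)
    ultimately show ?thesis unfolding mod d_def dist_norm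
      by (metis minus_diff_eq scaleR_minus_right)
  next
    case False
    then have "Suc k mod n = Suc k" using that by simp
    then show ?thesis using polar[of "e k"] False
      by (simp add: a_def e_def dist_norm norm_minus_commute)
  qed
  show thesis by (rule that[of "\<lambda>k. \<alpha> + a k"]) (use a_edge a_mono a_total in auto)
qed

section \<open>Length and shoelace sum of a polygon in a disc\<close>

text \<open>
  If the edge direction is \<open>a\<close>, the outer normal of a counterclockwise polygon is \<open>(sin a, - cos a)\<close>, so
  \<open>h\<close> is the support function of the point \<open>x\<close>.  The derivative of the potential is
  \<open>(h\<^sup>2 - h'\<^sup>2) / 2 - 2 r h + 3/2 r\<^sup>2\<close>, because \<open>h'' = - h\<close>; it is at least \<open>(r - h)\<^sup>2\<close> because
  \<open>h\<^sup>2 + h'\<^sup>2\<close> is the squared norm of \<open>x\<close>, hence at most \<open>r\<^sup>2\<close>.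
\<close>
lemma vertex_potential_mono:
  fixes x :: "real^2"
  defines "h \<equiv> \<lambda>a. x$1 * sin a - x$2 * cos a"
    and "h' \<equiv> \<lambda>a. x$1 * cos a + x$2 * sin a"
  assumes x: "norm x \<le> r" and ab: "a \<le> b"
  shows "2 * r * h' a - h a * h' a / 2 + 3 / 2 * r^2 * a
       \<le> 2 * r * h' b - h b * h' b / 2 + 3 / 2 * r^2 * b"
proof (rule DERIV_nonneg_imp_nondecreasing[OF ab])
  fix t
  have "(h has_real_derivative h' t) (at t)"
    unfolding h_def h'_def by (auto intro!: derivative_eq_intros)
  moreover have "(h' has_real_derivative - h t) (at t)"
    unfolding h_def h'_def by (auto intro!: derivative_eq_intros)
  ultimately have "((\<lambda>t. 2 * r * h' t - h t * h' t / 2 + 3 / 2 * r^2 * t) has_real_derivative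
     (((h t)^2 - (h' t)^2) / 2 - 2 * r * h t + 3 / 2 * r^2)) (at t)"
    by (auto intro!: derivative_eq_intros simp: field_simps power2_eq_square)
  moreover have "0 \<le> ((h t)^2 - (h' t)^2) / 2 - 2 * r * h t + 3 / 2 * r^2"
  proof -
    have "(h t)^2 + (h' t)^2 = ((x$1)^2 + (x$2)^2) * ((sin t)^2 + (cos t)^2)"
      unfolding h_def h'_def by (simp only: power2_eq_square) algebra
    also have "\<dots> = (norm x)^2" by (simp add: norm_vec2_sq)
    also have "\<dots> \<le> r^2" using x by (intro power_mono) auto
    finally have "(h t)^2 + (h' t)^2 \<le> r^2" .
    moreover have "0 \<le> (r - h t)^2" by simp
    ultimately show ?thesis unfolding power2_diff by argo
  qed
  ultimately show "\<exists>y. ((\<lambda>t. 2 * r * h' t - h t * h' t / 2 + 3 / 2 * r^2 * t)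
      has_real_derivative y) (at t) \<and> 0 \<le> y"
    by blast
qed

text \<open>
  Around vertex \<open>k + 1\<close> the edge direction turns from \<open>a k\<close> to \<open>a (k + 1)\<close>.  The increments of the
  potential over these intervals are nonnegative; summing them cyclically and regrouping by edges
  gives the claim.  The potential is the periodic function \<open>f\<close> plus a multiple of the angle, so the
  angle \<open>2 \<pi>\<close> that has to be added at vertex \<open>0\<close> contributes exactly the term \<open>3 \<pi> r\<^sup>2\<close>.
\<close>
lemma inscribed_polygon_length_le_shoelace:
  fixes p :: "(real^2) list"
  assumes p: "convex_polygon p" and n: "n = length p" "3 \<le> n"
    and disc: "set p \<subseteq> cball c r"
  shows "2 * r * polygon_length p - 3 * pi * r^2
       \<le> (\<Sum>k<n. wedge (p ! k - c) (p ! (Suc k mod n) - c)) / 2"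
proof -
  obtain a where edge: "\<And>k. k < n \<Longrightarrow>
      p ! (Suc k mod n) - p ! k = dist (p ! k) (p ! (Suc k mod n)) *\<^sub>R unit_vec (a k)"
    and a_mono: "\<And>k. Suc k < n \<Longrightarrow> a k \<le> a (Suc k)" and a_total: "a (n - 1) \<le> a 0 + 2 * pi"
    using convex_polygon_edge_angles[OF p n] by metis
  define x where "x k = p ! k - c" for k
  define l where "l k = dist (p ! k) (p ! (Suc k mod n))" for k
  define s where "s k = Suc k mod n" for k
  define f where "f y t = 2 * r * (y$1 * cos t + y$2 * sin t)
      - (y$1 * sin t - y$2 * cos t) * (y$1 * cos t + y$2 * sin t) / 2" for y :: "real^2" and t
  have s_less: "s k < n" for k unfolding s_def by (rule mod_less_divisor) (use n in linarith)
  have x_norm: "norm (x k) \<le> r" if "k < n" for k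
  proof -
    have "p ! k \<in> cball c r" using disc that n nth_mem by blast
    then show ?thesis by (simp add: x_def dist_norm norm_minus_commute)
  qed
  have "f (x (s k)) (a k) + 3 / 2 * r^2 * a k
      \<le> f (x (s k)) (a (s k)) + 3 / 2 * r^2 * (a (s k) + (if k = n - 1 then 2 * pi else 0))"
    if k: "k < n" for k
  proof (cases "k = n - 1")
    case True
    then have "s k = 0" using k by (simp add: s_def)
    then show ?thesis using True a_total
      vertex_potential_mono[OF x_norm[OF s_less], of "a k" "a (s k) + 2 * pi" k] by (simp add: f_def)
  next
    case False
    then have "Suc k < n" "s k = Suc k" using k by (auto simp: s_def)
    then show ?thesis using False
      vertex_potential_mono[OF x_norm[OF s_less], of "a k" "a (s k)" k] a_mono[of k] by (simp add: f_def)
  qed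
  then have "(\<Sum>k<n. f (x (s k)) (a k) + 3 / 2 * r^2 * a k)
      \<le> (\<Sum>k<n. f (x (s k)) (a (s k)) + 3 / 2 * r^2 * (a (s k) + (if k = n - 1 then 2 * pi else 0)))"
    by (intro sum_mono) auto
  also have "\<dots> = (\<Sum>k<n. f (x (s k)) (a (s k)) + 3 / 2 * r^2 * a (s k))
      + 3 / 2 * r^2 * (\<Sum>k<n. if k = n - 1 then 2 * pi else 0)"
    by (simp only: sum.distrib sum_distrib_left distrib_left add.assoc)
  also have "(\<Sum>k<n. if k = n - 1 then 2 * pi else 0) = 2 * pi"
    using n(2) by simp
  also have "(\<Sum>k<n. f (x (s k)) (a (s k)) + 3 / 2 * r^2 * a (s k))
      = (\<Sum>k<n. f (x k) (a k) + 3 / 2 * r^2 * a k)"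
    unfolding s_def by (rule cyclic_sum_shift)
  finally have "0 \<le> (\<Sum>k<n. f (x k) (a k) - f (x (s k)) (a k)) + 3 * pi * r^2"
    by (simp add: sum.distrib sum_subtractf algebra_simps)
  also have "(\<Sum>k<n. f (x k) (a k) - f (x (s k)) (a k))
      = (\<Sum>k<n. wedge (x k) (x (s k)) / 2 - 2 * r * l k)"
  proof (intro sum.cong refl)
    fix k assume "k \<in> {..<n}"
    then have "x (s k) = x k + l k *\<^sub>R unit_vec (a k)"
      using edge[of k] by (simp add: x_def s_def l_def algebra_simps)
    then have xs: "x (s k) $ 1 = x k $ 1 + l k * cos (a k)" "x (s k) $ 2 = x k $ 2 + l k * sin (a k)"
      by simp_all
    \<comment> \<open>Both end points of an edge have the same \<open>h\<close>, their \<open>h'\<close> differ by \<open>l k\<close>, and \<open>h * l k\<close> is the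
      shoelace term.\<close>
    have "(sin (a k))^2 + (cos (a k))^2 = 1" by simp
    then show "f (x k) (a k) - f (x (s k)) (a k) = wedge (x k) (x (s k)) / 2 - 2 * r * l k"
      unfolding f_def wedge_def xs by algebra
  qed
  also have "\<dots> = (\<Sum>k<n. wedge (x k) (x (s k))) / 2 - 2 * r * polygon_length p"
    by (simp add: sum_subtractf polygon_length_def n l_def sum_distrib_left sum_divide_distrib)
  finally show ?thesis by (simp add: x_def s_def)
qed

section \<open>The shoelace sum as an area\<close>

text \<open>
  Moving the origin from \<open>c\<close> to the first vertex changes each shoelace term by a difference that
  cancels around the polygon; the two edges at the first vertex then contribute nothing.
\<close>
lemma shoelace_eq_fan:
  fixes p :: "(real^2) list"
  assumes n: "n = length p" "2 \<le> n"
  shows "(\<Sum>k<n. wedge (p ! k - c) (p ! (Suc k mod n) - c))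
       = (\<Sum>k\<in>{1..<n - 1}. orient (p ! 0) (p ! k) (p ! Suc k))"
proof -
  define q where "q k = p ! k - p ! 0" for k
  define u where "u = p ! 0 - c"
  define s where "s k = Suc k mod n" for k
  have "wedge (p ! k - c) (p ! s k - c) = wedge (q k) (q (s k)) + (wedge u (q (s k)) - wedge u (q k))" for k
    by (simp add: wedge_def q_def u_def algebra_simps)
  then have "(\<Sum>k<n. wedge (p ! k - c) (p ! s k - c))
      = (\<Sum>k<n. wedge (q k) (q (s k))) + ((\<Sum>k<n. wedge u (q (s k))) - (\<Sum>k<n. wedge u (q k)))"
    by (simp add: sum.distrib sum_subtractf)
  also have "(\<Sum>k<n. wedge u (q (s k))) = (\<Sum>k<n. wedge u (q k))"
    unfolding s_def by (rule cyclic_sum_shift)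
  also have "(\<Sum>k<n. wedge (q k) (q (s k))) = (\<Sum>k\<in>{1..<n - 1}. wedge (q k) (q (s k)))"
  proof (rule sum.mono_neutral_right)
    show "\<forall>k\<in>{..<n} - {1..<n - 1}. wedge (q k) (q (s k)) = 0"
    proof
      fix k assume "k \<in> {..<n} - {1..<n - 1}"
      then have "k = 0 \<or> Suc k = n" by auto
      then have "k = 0 \<or> s k = 0" by (auto simp: s_def)
      then show "wedge (q k) (q (s k)) = 0" by (auto simp: wedge_def q_def)
    qed
  qed auto
  also have "\<dots> = (\<Sum>k\<in>{1..<n - 1}. orient (p ! 0) (p ! k) (p ! Suc k))"
    by (intro sum.cong) (auto simp: s_def q_def orient_eq_wedge)
  finally show ?thesis by (simp add: s_def)
qed

lemma convex_orient_nonneg: "convex {x. 0 \<le> orient a b x}"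
  and convex_orient_nonpos: "convex {x. orient a b x \<le> 0}"
proof -
  have *: "orient a b ((1 - t) *\<^sub>R x + t *\<^sub>R y) = (1 - t) * orient a b x + t * orient a b y" for x y t
    by (simp add: orient_def algebra_simps)
  show "convex {x. 0 \<le> orient a b x}"
    unfolding convex_alt by (auto simp: *)
  show "convex {x. orient a b x \<le> 0}"
    unfolding convex_alt by (auto simp: * intro!: add_nonpos_nonpos mult_nonneg_nonpos)
qed

lemma negligible_orient_zero:
  assumes "a \<noteq> b"
  shows "negligible {x. orient a b x = 0}"
proof -
  define w :: "real^2" where "w = vector [- (b$2 - a$2), b$1 - a$1]"
  have "w \<noteq> 0" using assms by (auto simp: w_def vec2_eq_iff)
  moreover have "orient a b x = w \<bullet> x - w \<bullet> a" for x
    by (simp add: orient_def w_def inner_vec_def sum_2 algebra_simps)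
  ultimately show ?thesis
    using negligible_hyperplane[of w "w \<bullet> a"] by simp
qed

text \<open>
  Distinct triangles of the fan lie on different sides of a diagonal, so they overlap in a null set.
\<close>
lemma fan_area_le_measure:
  fixes p :: "(real^2) list"
  assumes p: "convex_polygon p" and n: "n = length p" "3 \<le> n"
    and S: "compact S" "convex S" "set p \<subseteq> S"
  shows "(\<Sum>k\<in>{1..<n - 1}. orient (p ! 0) (p ! k) (p ! Suc k)) / 2 \<le> measure lebesgue S"
proof -
  define T where "T k = convex hull {p ! 0, p ! k, p ! Suc k}" for k
  have orient_pos: "0 < orient (p ! i) (p ! j) (p ! k)" if "i < j" "j < k" "k < n" for i j k
    using p that n unfolding convex_polygon_def by blast
  have T_meas: "T k \<in> lmeasurable" for k
    unfolding T_def by (intro lmeasurable_compact finite_imp_compact_convex_hull) simp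
  have T_sub: "T k \<subseteq> S" if "k < n - 1" for k
    unfolding T_def using that n S by (intro hull_minimal) (auto intro!: subsetD[OF S(3)] nth_mem)
  have T_area: "measure lebesgue (T k) = orient (p ! 0) (p ! k) (p ! Suc k) / 2"
    if "k \<in> {1..<n - 1}" for k
  proof -
    have "measure lebesgue (T k) = measure lborel (T k)"
      unfolding T_def by (intro measure_completion) (simp add: borel_compact finite_imp_compact_convex_hull)
    also have "\<dots> = \<bar>- orient (p ! 0) (p ! k) (p ! Suc k)\<bar> / 2"
      unfolding T_def content_triangle by (simp add: orient_def mult.commute)
    also have "\<dots> = orient (p ! 0) (p ! k) (p ! Suc k) / 2"
      using orient_pos[of 0 k "Suc k"] that by (simp add: less_diff_conv)
    finally show ?thesis .
  qed
  have null: "negligible (T j \<inter> T k)" if jk: "1 \<le> j" "j < k" "k < n - 1" for j k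
  proof (rule negligible_subset)
    have pos: "0 < orient (p ! 0) (p ! k) (p ! Suc k)" using jk by (intro orient_pos) auto
    then have "p ! 0 \<noteq> p ! k" by (auto simp: orient_def)
    then show "negligible {x. orient (p ! 0) (p ! k) x = 0}" by (rule negligible_orient_zero)
    have flip: "orient x y z = - orient x z y" for x y z by (simp add: orient_def)
    have self: "orient x y x = 0" "orient x y y = 0" for x y by (simp_all add: orient_def)
    have neg: "orient (p ! 0) (p ! k) (p ! i) \<le> 0" if "1 \<le> i" "i \<le> k" for i
      using orient_pos[of 0 i k] that jk flip[of "p ! 0" "p ! k" "p ! i"] self
      by (cases "i = k") (auto simp: less_diff_conv less_imp_le)
    have "T j \<subseteq> {x. orient (p ! 0) (p ! k) x \<le> 0}"
      unfolding T_def using neg[of j] neg[of "Suc j"] jk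
      by (intro hull_minimal convex_orient_nonpos) (auto simp: self)
    moreover have "T k \<subseteq> {x. 0 \<le> orient (p ! 0) (p ! k) x}"
      unfolding T_def using pos by (intro hull_minimal convex_orient_nonneg) (auto simp: self)
    ultimately show "T j \<inter> T k \<subseteq> {x. orient (p ! 0) (p ! k) x = 0}" by force
  qed
  have "(\<Sum>k\<in>{1..<n - 1}. orient (p ! 0) (p ! k) (p ! Suc k)) / 2
      = (\<Sum>k\<in>{1..<n - 1}. measure lebesgue (T k))"
    by (simp add: T_area sum_divide_distrib)
  also have "\<dots> = measure lebesgue (\<Union>(T ` {1..<n - 1}))"
  proof (rule measure_negligible_finite_Union_image[symmetric])
    show "pairwise (\<lambda>j k. negligible (T j \<inter> T k)) {1..<n - 1}"
      unfolding pairwise_def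
    proof (intro ballI impI)
      fix j k assume "j \<in> {1..<n - 1}" "k \<in> {1..<n - 1}" "j \<noteq> k"
      then show "negligible (T j \<inter> T k)"
        using null[of j k] null[of k j] by (cases "j < k") (auto simp: Int_commute)
    qed
  qed (use T_meas in auto)
  also have "\<dots> \<le> measure lebesgue S"
  proof (rule measure_mono_fmeasurable)
    show "\<Union>(T ` {1..<n - 1}) \<subseteq> S" using T_sub by fastforce
    show "\<Union>(T ` {1..<n - 1}) \<in> sets lebesgue"
      using T_meas by (intro sets.finite_UN) (auto dest: fmeasurableD)
    show "S \<in> lmeasurable" using S by (simp add: lmeasurable_compact)
  qed
  finally show ?thesis .
qed

text \<open>
  Polygons with at most two vertices enclose no area; for them the length is at most twice the
  diameter \<open>2 r\<close>, and \<open>8 \<le> 3 \<pi>\<close> suffices.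
\<close>
theorem inscribed_polygon_area_bound:
  fixes S :: "(real^2) set"
  assumes S: "compact S" "convex S" "S \<subseteq> cball c r" and p: "convex_polygon p" "set p \<subseteq> S"
  shows "2 * r * polygon_length p - 3 * pi * r^2 \<le> measure lebesgue S"
proof (cases "3 \<le> length p")
  case True
  have "2 * r * polygon_length p - 3 * pi * r^2
      \<le> (\<Sum>k<length p. wedge (p ! k - c) (p ! (Suc k mod length p) - c)) / 2"
    using p S True by (intro inscribed_polygon_length_le_shoelace) auto
  also have "\<dots> = (\<Sum>k\<in>{1..<length p - 1}. orient (p ! 0) (p ! k) (p ! Suc k)) / 2"
    using True by (subst shoelace_eq_fan) auto
  also have "\<dots> \<le> measure lebesgue S"
    using p S True by (intro fan_area_le_measure) auto
  finally show ?thesis .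
next
  case False
  have "2 * r * polygon_length p \<le> 8 * r^2"
  proof (cases "length p = 2")
    case True
    then have "p ! 0 \<in> cball c r" "p ! 1 \<in> cball c r" using p S by (auto simp: subset_iff)
    then have "dist (p ! 0) (p ! 1) \<le> 2 * r" "0 \<le> r"
      using dist_triangle2[of "p ! 0" "p ! 1" c] zero_le_dist[of c "p ! 0"]
      by (auto simp: dist_commute simp del: zero_le_dist)
    moreover have "polygon_length p = 2 * dist (p ! 0) (p ! 1)"
      using True by (simp add: polygon_length_def numeral_2_eq_2 dist_commute)
    ultimately show ?thesis
      using mult_left_mono[of "dist (p ! 0) (p ! 1)" "2 * r" "4 * r"] by (simp add: power2_eq_square)
  next
    case 2: False
    with False have "length p = 0 \<or> length p = 1" by linarith
    then have "polygon_length p = 0" by (auto simp: polygon_length_def)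
    then show ?thesis by simp
  qed
  moreover have "8 * r^2 \<le> 3 * pi * r^2"
    using pi_gt3 by (intro mult_right_mono) auto
  ultimately show ?thesis using measure_nonneg[of lebesgue S] by linarith
qed

section \<open>Discs\<close>

lemma dist_unit_vec: "dist (unit_vec a) (unit_vec b) = 2 * \<bar>sin ((b - a) / 2)\<bar>"
proof (rule power2_eq_imp_eq)
  define t where "t = (b - a) / 2"
  then have t: "b - a = 2 * t" by simp
  have "(dist (unit_vec a) (unit_vec b))^2 = (cos a - cos b)^2 + (sin a - sin b)^2"
    by (simp add: dist_norm norm_vec2_sq)
  also have "\<dots> = 2 - 2 * cos (b - a)"
    using sin_cos_squared_add[of a] sin_cos_squared_add[of b] unfolding cos_diff by algebra
  also have "\<dots> = 4 * (sin t)^2" unfolding t cos_double_sin by simp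
  finally show "(dist (unit_vec a) (unit_vec b))^2 = (2 * \<bar>sin ((b - a) / 2)\<bar>)^2"
    unfolding t by (simp add: power_mult_distrib)
qed auto

lemma orient_unit_vec_pos:
  assumes "a < b" "b < d" "d < a + 2 * pi"
  shows "0 < orient (unit_vec a) (unit_vec b) (unit_vec d)"
proof -
  define x y where "x = (b - a) / 2" and "y = (d - b) / 2"
  have "orient (unit_vec a) (unit_vec b) (unit_vec d) = sin (b - a) + sin (d - b) - sin ((b - a) + (d - b))"
    unfolding orient_def by (simp add: sin_diff algebra_simps)
  also have "\<dots> = sin (2 * x) + sin (2 * y) - sin (2 * x + 2 * y)"
  proof -
    have "b - a = 2 * x" "d - b = 2 * y" by (simp_all add: x_def y_def)
    then show ?thesis by (simp only:)
  qed
  \<comment> \<open>By the inscribed angle theorem the triangle has the angles \<open>x\<close>, \<open>y\<close> and \<open>\<pi> - x - y\<close>; with unit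
    circumradius, twice its area is \<open>4\<close> times the product of their sines.\<close>
  also have "\<dots> = 4 * sin x * sin y * sin (x + y)"
    using sin_cos_squared_add[of x] sin_cos_squared_add[of y]
    unfolding sin_add sin_double cos_double by algebra
  finally have "orient (unit_vec a) (unit_vec b) (unit_vec d) = 4 * sin x * sin y * sin (x + y)" .
  moreover have "0 < sin x" "0 < sin y" "0 < sin (x + y)"
    by (rule sin_gt_zero; use assms in \<open>simp add: x_def y_def field_simps\<close>)+
  ultimately show ?thesis by simp
qed

lemma regular_polygon_exists:
  fixes c :: "real^2"
  assumes r: "0 < r" and n: "2 \<le> n"
  obtains p where "convex_polygon p" "set p \<subseteq> sphere c r"
    "polygon_length p = 2 * r * (real n * sin (pi / real n))"
proof -
  define \<theta> where "\<theta> k = 2 * pi * real k / real n" for k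
  define p where "p = map (\<lambda>k. c + r *\<^sub>R unit_vec (\<theta> k)) [0..<n]"
  have p_nth: "p ! k = c + r *\<^sub>R unit_vec (\<theta> k)" if "k < n" for k
    using that by (simp add: p_def)
  have len: "length p = n" by (simp add: p_def)
  have "convex_polygon p"
    unfolding convex_polygon_def len
  proof (intro allI impI)
    fix i j k assume ijk: "i < j \<and> j < k \<and> k < n"
    have "orient (p ! i) (p ! j) (p ! k) = r^2 * orient (unit_vec (\<theta> i)) (unit_vec (\<theta> j)) (unit_vec (\<theta> k))"
      using ijk by (simp add: p_nth orient_def power2_eq_square algebra_simps)
    moreover have "0 < orient (unit_vec (\<theta> i)) (unit_vec (\<theta> j)) (unit_vec (\<theta> k))"
    proof (rule orient_unit_vec_pos)
      show "\<theta> i < \<theta> j" "\<theta> j < \<theta> k"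
        using ijk by (auto simp: \<theta>_def divide_strict_right_mono)
      have "\<theta> k < 2 * pi" "0 \<le> \<theta> i" using ijk by (auto simp: \<theta>_def divide_simps)
      then show "\<theta> k < \<theta> i + 2 * pi" by simp
    qed
    ultimately show "0 < orient (p ! i) (p ! j) (p ! k)" using r by simp
  qed
  moreover have "set p \<subseteq> sphere c r"
  proof -
    have "norm (unit_vec t) = 1" for t
      using norm_vec2_sq[of "unit_vec t"] by (simp add: power2_eq_1_iff) (smt (verit) norm_ge_zero)
    then show ?thesis using r by (auto simp: p_def dist_norm)
  qed
  moreover have "polygon_length p = 2 * r * (real n * sin (pi / real n))"
  proof -
    have "dist (p ! k) (p ! (Suc k mod n)) = 2 * r * sin (pi / real n)" if k: "k < n" for k
    proof -
      have "0 < sin (pi / real n)" using n by (intro sin_gt_zero) (auto simp: divide_simps)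
      moreover have "\<bar>sin ((\<theta> (Suc k mod n) - \<theta> k) / 2)\<bar> = \<bar>sin (pi / real n)\<bar>"
      proof (cases "Suc k = n")
        case True
        then have "(\<theta> (Suc k mod n) - \<theta> k) / 2 = pi / real n - pi"
          using n by (auto simp: \<theta>_def field_simps)
        then show ?thesis by (simp only: sin_diff) simp
      next
        case False
        then have "Suc k mod n = Suc k" using k by simp
        then have "(\<theta> (Suc k mod n) - \<theta> k) / 2 = pi / real n"
          using n by (auto simp: \<theta>_def field_simps)
        then show ?thesis by simp
      qed
      moreover have "dist (p ! k) (p ! (Suc k mod n))
          = r * dist (unit_vec (\<theta> k)) (unit_vec (\<theta> (Suc k mod n)))"
        using k r by (simp add: p_nth dist_norm flip: scaleR_diff_right)
      ultimately show ?thesis by (simp add: dist_unit_vec)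
    qed
    then show ?thesis by (simp add: polygon_length_def len)
  qed
  ultimately show thesis by (rule that)
qed

lemma circumradius_cball:
  fixes c :: "real^2"
  assumes "0 \<le> r"
  shows "circumradius (cball c r) = r"
  unfolding circumradius_def
proof (rule cInf_eq_minimum)
  fix s assume "s \<in> {s. 0 \<le> s \<and> (\<exists>c'. cball c r \<subseteq> cball c' s)}"
  then obtain c' where "cball c r \<subseteq> cball c' s" by blast
  then show "r \<le> s" using assms zero_le_dist[of c c'] unfolding cball_subset_cball_iff by linarith
qed (use assms in auto)

lemma measure_cball_plane:
  fixes c :: "real^2"
  assumes "0 \<le> r"
  shows "measure lebesgue (cball c r) = pi * r^2"
  using assms by (simp add: content_cball unit_ball_vol_2)

text \<open>
  The upper bound is the polygon inequality applied to the disc itself; it also provides the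
  boundedness that is needed to compare the supremum with the regular polygons.
\<close>
lemma perimeter_cball:
  fixes c :: "real^2"
  assumes r: "0 < r"
  shows "perimeter (cball c r) = 2 * pi * r"
proof -
  define L where "L = {polygon_length p | p. convex_polygon p \<and> set p \<subseteq> frontier (cball c r)}"
  have upper: "l \<le> 2 * pi * r" if l: "l \<in> L" for l
  proof -
    obtain p where p: "convex_polygon p" "set p \<subseteq> sphere c r" "l = polygon_length p"
      using l unfolding L_def by (auto simp del: mem_sphere)
    then have "2 * r * l - 3 * pi * r^2 \<le> measure lebesgue (cball c r)"
      using inscribed_polygon_area_bound[of "cball c r" c r p] by force
    then have "2 * r * l \<le> 2 * r * (2 * pi * r)"
      using r measure_cball_plane[of r c] by (simp add: power2_eq_square)
    then show ?thesis using r by simp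
  qed
  have "Sup L \<le> 2 * pi * r"
  proof (rule cSup_least)
    show "L \<noteq> {}" by (auto simp: L_def convex_polygon_def intro!: exI[of _ "[]"])
  qed (rule upper)
  moreover have "2 * pi * r \<le> Sup L"
  proof (rule LIMSEQ_le_const2)
    have "(\<lambda>n. real n * sin (pi / real n)) \<longlonglongrightarrow> pi"
    proof -
      have "filterlim (\<lambda>n. pi / real n) (at 0) sequentially"
        unfolding filterlim_at
        using lim_const_over_n[of pi] eventually_gt_at_top[of "0::nat"] by (auto elim: eventually_mono)
      moreover have "((\<lambda>t::real. sin t / t) \<longlongrightarrow> 1) (at 0)"
        using DERIV_sin[of "0::real"] by (simp add: DERIV_def)
      ultimately have "(\<lambda>n. sin (pi / real n) / (pi / real n)) \<longlonglongrightarrow> 1"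
        by (rule filterlim_compose[rotated])
      then show ?thesis
        using tendsto_mult_left[of "\<lambda>n. sin (pi / real n) / (pi / real n)" 1 sequentially pi]
        by (simp add: mult.commute)
    qed
    then show "(\<lambda>n. 2 * r * (real n * sin (pi / real n))) \<longlonglongrightarrow> 2 * pi * r"
      using tendsto_mult_left[of "\<lambda>n. real n * sin (pi / real n)" pi sequentially "2 * r"]
      by (simp add: mult_ac)
    show "\<exists>N. \<forall>n\<ge>N. 2 * r * (real n * sin (pi / real n)) \<le> Sup L"
    proof (intro exI[of _ 2] allI impI)
      fix n :: nat assume "2 \<le> n"
      then obtain p where "convex_polygon p" "set p \<subseteq> sphere c r"
        "polygon_length p = 2 * r * (real n * sin (pi / real n))"
        using regular_polygon_exists[OF r] by blast
      then have "2 * r * (real n * sin (pi / real n)) \<in> L"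
        unfolding L_def by (force simp del: mem_sphere)
      then show "2 * r * (real n * sin (pi / real n)) \<le> Sup L"
        by (rule cSup_upper) (rule bdd_aboveI[OF upper])
    qed
  qed
  ultimately show ?thesis by (simp add: perimeter_def L_def)
qed

section \<open>Passing to the circumradius and the perimeter\<close>

lemma enclosing_radii_nonempty:
  fixes S :: "(real^2) set"
  assumes "bounded S"
  shows "{r. 0 \<le> r \<and> (\<exists>c. S \<subseteq> cball c r)} \<noteq> {}"
proof -
  obtain c r where "S \<subseteq> cball c r" using assms bounded_subset_cball by blast
  also have "cball c r \<subseteq> cball c (max 0 r)" by (rule subset_cball) simp
  finally show ?thesis by force
qed

lemma circumradius_nonneg: "bounded S \<Longrightarrow> 0 \<le> circumradius S"
  unfolding circumradius_def by (rule cInf_greatest[OF enclosing_radii_nonempty]) auto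

lemma subset_cball_above_circumradius:
  assumes S: "bounded S" and r: "circumradius S < r"
  obtains c where "S \<subseteq> cball c r"
proof -
  obtain s where s: "s \<in> {r. 0 \<le> r \<and> (\<exists>c. S \<subseteq> cball c r)}" "s < r"
    using cInf_lessD[OF enclosing_radii_nonempty[OF S] r[unfolded circumradius_def]] by blast
  then obtain c where "S \<subseteq> cball c s" by blast
  also have "cball c s \<subseteq> cball c r" using s(2) by (intro subset_cball) simp
  finally show thesis by (rule that)
qed

text \<open>
  Every radius above the circumradius belongs to a disc that contains \<open>S\<close>, so the polygon inequality
  holds for it; letting the radius decrease to the circumradius preserves the inequality by
  continuity.  Solved for the length, it bounds all inscribed polygons at once.
\<close>
theorem measure_ge_circumradius_perimeter:
  fixes S :: "(real^2) set"
  assumes S: "compact S" "convex S"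
  shows "circumradius S * (2 * perimeter S - 3 * pi * circumradius S) \<le> measure lebesgue S"
proof (cases "circumradius S = 0")
  case False
  define R where "R = circumradius S"
  have R: "0 < R" using False circumradius_nonneg[OF compact_imp_bounded[OF S(1)]] by (simp add: R_def)
  define L where "L = {polygon_length p | p. convex_polygon p \<and> set p \<subseteq> frontier S}"
  have "l \<le> (measure lebesgue S + 3 * pi * R^2) / (2 * R)" if l: "l \<in> L" for l
  proof -
    obtain p where p: "convex_polygon p" "set p \<subseteq> S" "l = polygon_length p"
      using l frontier_subset_compact[OF S(1)] unfolding L_def by blast
    have "2 * R * l - 3 * pi * R^2 \<le> measure lebesgue S"
    proof (rule tendsto_upperbound)
      show "((\<lambda>r. 2 * r * l - 3 * pi * r^2) \<longlongrightarrow> 2 * R * l - 3 * pi * R^2) (at_right R)"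
        by (intro tendsto_intros)
      show "\<forall>\<^sub>F r in at_right R. 2 * r * l - 3 * pi * r^2 \<le> measure lebesgue S"
      proof (rule eventually_at_right_less[THEN eventually_mono])
        fix r assume "R < r"
        then obtain c where "S \<subseteq> cball c r"
          using subset_cball_above_circumradius[OF compact_imp_bounded[OF S(1)]] R_def by blast
        then show "2 * r * l - 3 * pi * r^2 \<le> measure lebesgue S"
          unfolding p(3) using S p by (intro inscribed_polygon_area_bound)
      qed
    qed simp
    then show ?thesis using R by (simp add: field_simps)
  qed
  moreover have "L \<noteq> {}" by (auto simp: L_def convex_polygon_def intro!: exI[of _ "[]"])
  ultimately have "Sup L \<le> (measure lebesgue S + 3 * pi * R^2) / (2 * R)"
    by (intro cSup_least)
  then have "2 * R * perimeter S \<le> measure lebesgue S + 3 * pi * R^2"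
    using R by (simp add: perimeter_def L_def field_simps)
  then show ?thesis by (simp add: R_def power2_eq_square algebra_simps)
qed simp

theorem proposition5p3:
  fixes \<Omega> :: "(real^2) set"
  assumes "compact \<Omega>" and "convex \<Omega>"
  shows "measure lebesgue \<Omega> \<ge>
           circumradius \<Omega> * (2 * perimeter \<Omega> - 3 * pi * circumradius \<Omega>) \<and>
         ((\<exists>c r. 0 < r \<and> \<Omega> = cball c r) \<longrightarrow>
           measure lebesgue \<Omega> =
             circumradius \<Omega> * (2 * perimeter \<Omega> - 3 * pi * circumradius \<Omega>)) \<and>
         (perimeter \<Omega> \<ge> (3 * pi - 4) * circumradius \<Omega> \<longrightarrow>
           circumradius \<Omega> * (2 * perimeter \<Omega> - 3 * pi * circumradius \<Omega>) \<ge>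
             circumradius \<Omega> * (perimeter \<Omega> - 4 * circumradius \<Omega>))"
proof (intro conjI impI)
  show "circumradius \<Omega> * (2 * perimeter \<Omega> - 3 * pi * circumradius \<Omega>) \<le> measure lebesgue \<Omega>"
    using assms by (rule measure_ge_circumradius_perimeter)
next
  assume "\<exists>c r. 0 < r \<and> \<Omega> = cball c r"
  then obtain c r where "0 < r" "\<Omega> = cball c r" by blast
  then show "measure lebesgue \<Omega> =
      circumradius \<Omega> * (2 * perimeter \<Omega> - 3 * pi * circumradius \<Omega>)"
    using measure_cball_plane[of r c]
    by (simp add: circumradius_cball perimeter_cball power2_eq_square algebra_simps)
next
  assume "(3 * pi - 4) * circumradius \<Omega> \<le> perimeter \<Omega>"
  then show "circumradius \<Omega> * (perimeter \<Omega> - 4 * circumradius \<Omega>)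
      \<le> circumradius \<Omega> * (2 * perimeter \<Omega> - 3 * pi * circumradius \<Omega>)"
    using circumradius_nonneg[OF compact_imp_bounded[OF assms(1)]]
    by (intro mult_left_mono) (simp_all add: algebra_simps)
qed

end
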